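(* Let $n\ge3$, $\lambda=\frac{n-1}2$, $\rho>0$ and $\zeta=e^{-\rho}\widehat e$. The second directional derivative $(p_\zeta^\lambda)^{(2)}(x)=\frac{\partial^2}{\partial\Theta^2}\,p_\zeta^\lambda(\Upsilon_\Theta x)\big|_{\Theta=0}$ of the Poisson kernel on $\mathcal S^n$ has the explicit representation $$ \left(p_\zeta^\lambda\right)^{(2)}(x) =-\frac{2(\lambda+1)\,e^{-\rho}\,(1-e^{-2\rho})}{\Sigma_n\,(1-2e^{-\rho}\cos\theta_1+e^{-2\rho})^{\lambda+2}}\,\cos\theta_1 +\frac{4(\lambda+1)(\lambda+2)\,e^{-2\rho}\,(1-e^{-2\rho})}{\Sigma_n\,(1-2e^{-\rho}\cos\theta_1+e^{-2\rho})^{\lambda+3}}\,\sin^2\theta_1\cos^2\theta_2 $$ for $x\in\mathcal S^n$ with spherical coordinates $(\theta_1,\theta_2,\dots,\theta_{n-1},\varphi)$.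
   Context: $\mathcal S^n\subset\mathbb R^{n+1}$ is the unit sphere, $\Sigma_n=\frac{2\pi^{(n+1)/2}}{\Gamma((n+1)/2)}$ its total measure, $\widehat e=(1,0,\dots,0)$. Spherical coordinates satisfy $x_1=\cos\theta_1$, $x_2=\sin\theta_1\cos\theta_2$, $x_3=\sin\theta_1\sin\theta_2\cos\theta_3$, and so on. The Poisson kernel located at $\zeta=r\widehat e$, $0<r<1$, is $p_\zeta^\lambda(x)=\frac1{\Sigma_n}\frac{1-r^2}{(1-2r\cos\theta_1+r^2)^{\lambda+1}}$. $\Upsilon_\Theta$ is the rotation of $\mathbb R^{n+1}$ mapping $(x_1,x_2,x_3,\dots)$ to $(x_1\cos\Theta-x_2\sin\Theta,\;x_1\sin\Theta+x_2\cos\Theta,\;x_3,\dots)$. (The second-order directional Poisson wavelet is $g_\rho^{[2]}=\rho^2(p_\zeta^\lambda)^{(2)}$.) *)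

theory Defs
  imports "HOL-Analysis.Analysis"
begin

(* Points of R^(n+1) and of the unit sphere are functions nat => real as in the library's
   Euclidean_space (n+1) and nsphere n. Library coordinates start at 0, so the mathematical
   coordinate x_k is x (k - 1); in particular x_1 is x 0 and x_2 is x 1. *)

definition sphere_area :: "nat \<Rightarrow> real" where
  "sphere_area n = 2 * pi powr ((real n + 1) / 2) / Gamma ((real n + 1) / 2)"

(* Angles theta_1, ..., theta_(n-1) in [0,pi] are the values theta 1, ..., theta (n-1).
   At points where some sine vanishes the angles are not unique; hence a relation. *)
definition spherical_coordinates ::
    "nat \<Rightarrow> (nat \<Rightarrow> real) \<Rightarrow> real \<Rightarrow> (nat \<Rightarrow> real) \<Rightarrow> bool" where
  "spherical_coordinates n \<theta> \<phi> x \<longleftrightarrow>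
     (\<forall>k\<in>{1..n-1}. 0 \<le> \<theta> k \<and> \<theta> k \<le> pi) \<and> 0 \<le> \<phi> \<and> \<phi> < 2 * pi \<and>
     (\<forall>k\<in>{1..n-1}. x (k - 1) = (\<Prod>j=1..<k. sin (\<theta> j)) * cos (\<theta> k)) \<and>
     x (n - 1) = (\<Prod>j=1..<n. sin (\<theta> j)) * cos \<phi> \<and>
     x n = (\<Prod>j=1..<n. sin (\<theta> j)) * sin \<phi>"

(* The kernel located at r * (1,0,...,0), 0 < r < 1, as a function on the sphere;
   x 0 is cos theta_1. *)
definition poisson_kernel :: "nat \<Rightarrow> real \<Rightarrow> real \<Rightarrow> (nat \<Rightarrow> real) \<Rightarrow> real" where
  "poisson_kernel n lam r x =
     1 / sphere_area n * ((1 - r\<^sup>2) / (1 - 2 * r * x 0 + r\<^sup>2) powr (lam + 1))"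

definition rotation12 :: "real \<Rightarrow> (nat \<Rightarrow> real) \<Rightarrow> (nat \<Rightarrow> real)" where
  "rotation12 \<Theta> x =
     x(0 := x 0 * cos \<Theta> - x 1 * sin \<Theta>, 1 := x 0 * sin \<Theta> + x 1 * cos \<Theta>)"

definition directional_deriv ::
    "nat \<Rightarrow> ((nat \<Rightarrow> real) \<Rightarrow> real) \<Rightarrow> (nat \<Rightarrow> real) \<Rightarrow> real" where
  "directional_deriv d f x = (deriv ^^ d) (\<lambda>\<Theta>. f (rotation12 \<Theta> x)) 0"

end

theory Submission
  imports Defs
begin

text \<open>
  Along the orbit \<open>\<Theta> \<mapsto> \<Upsilon>\<^sub>\<Theta> x\<close> the kernel depends only on the first coordinate
  \<open>h(\<Theta>) = x\<^sub>1 cos \<Theta> - x\<^sub>2 sin \<Theta>\<close>, so it is a constant multiple of \<open>D powr -(\<lambda> + 1)\<close> with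
  \<open>D = 1 - 2 r h + r\<^sup>2\<close>. Each differentiation of a power of \<open>D\<close> lowers the exponent by one and
  brings out a factor \<open>-2 r h'\<close>; applying this rule twice gives, up to the constant,
  \[
    2 r (\<lambda> + 1) h'' D^{-(\<lambda>+2)} + 4 r^2 (\<lambda> + 1) (\<lambda> + 2) (h')^2 D^{-(\<lambda>+3)} .
  \]
  At \<open>\<Theta> = 0\<close> one has \<open>h' = -x\<^sub>2 = - sin \<theta>\<^sub>1 cos \<theta>\<^sub>2\<close> and \<open>h'' = -x\<^sub>1 = - cos \<theta>\<^sub>1\<close>, which is the
  claimed formula. The real powers are differentiable because \<open>D\<close> stays positive: \<open>\<bar>h\<bar> \<le> 1\<close>
  on the whole orbit, as \<open>x\<^sub>1\<^sup>2 + x\<^sub>2\<^sup>2 \<le> 1\<close>, and hence \<open>D \<ge> (1 - r)\<^sup>2 > 0\<close>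
  (\<open>poisson_denominator_pos\<close>).
\<close>

text \<open>By Cauchy-Schwarz the rotated coordinate stays in \<open>[-1, 1]\<close>, so the denominator is at
  least \<open>(1 - r)\<^sup>2\<close>.\<close>
lemma poisson_denominator_pos:
  fixes a b r t :: real
  assumes "a\<^sup>2 + b\<^sup>2 \<le> 1" "0 < r" "r < 1"
  shows "0 < 1 - 2 * r * (a * cos t - b * sin t) + r\<^sup>2"
proof -
  have "(a * cos t - b * sin t)\<^sup>2 + (a * sin t + b * cos t)\<^sup>2 = (a\<^sup>2 + b\<^sup>2) * ((sin t)\<^sup>2 + (cos t)\<^sup>2)"
    by algebra
  then have "(a * cos t - b * sin t)\<^sup>2 + (a * sin t + b * cos t)\<^sup>2 \<le> 1"
    using assms(1) by simp
  then have "(a * cos t - b * sin t)\<^sup>2 \<le> 1"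
    by (smt (verit) zero_le_power2)
  then have "a * cos t - b * sin t \<le> 1"
    unfolding abs_square_le_1 by linarith
  then have "r * (a * cos t - b * sin t) \<le> r * 1"
    using assms(2) by (intro mult_left_mono) auto
  then have "(1 - r)\<^sup>2 \<le> 1 - 2 * r * (a * cos t - b * sin t) + r\<^sup>2"
    by (simp add: power2_eq_square algebra_simps)
  moreover have "0 < (1 - r)\<^sup>2"
    using assms(3) by simp
  ultimately show ?thesis by linarith
qed

text \<open>The rule that is applied twice; \<open>s = \<lambda> + 1\<close> for the kernel itself and \<open>s = \<lambda> + 2\<close> for its
  derivative.\<close>
lemma has_real_derivative_poisson_denominator_powr:
  fixes a b r s t :: real
  assumes "0 < 1 - 2 * r * (a * cos t - b * sin t) + r\<^sup>2"
  shows "((\<lambda>t. (1 - 2 * r * (a * cos t - b * sin t) + r\<^sup>2) powr (- s)) has_real_derivative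
           2 * r * s * (- a * sin t - b * cos t) *
             (1 - 2 * r * (a * cos t - b * sin t) + r\<^sup>2) powr (- (s + 1))) (at t)"
proof -
  have eq: "- s - 1 = - (s + 1)" by simp
  have "((\<lambda>t. 1 - 2 * r * (a * cos t - b * sin t) + r\<^sup>2) has_real_derivative
          - 2 * r * (- a * sin t - b * cos t)) (at t)"
    by (auto intro!: derivative_eq_intros simp: algebra_simps)
  from DERIV_fun_powr[OF this assms, of "- s"] show ?thesis
    unfolding of_nat_1 eq by (simp add: algebra_simps)
qed

lemma poisson_kernel_rotation12:
  "poisson_kernel n lam r (rotation12 \<Theta> x) =
     (1 - r\<^sup>2) / sphere_area n *
       (1 - 2 * r * (x 0 * cos \<Theta> - x 1 * sin \<Theta>) + r\<^sup>2) powr (- (lam + 1))"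
  unfolding powr_minus by (simp add: poisson_kernel_def rotation12_def divide_inverse)

lemma
  fixes n :: nat and r lam :: real
  assumes "(x 0)\<^sup>2 + (x 1)\<^sup>2 \<le> 1" "0 < r" "r < 1"
  defines "D \<equiv> \<lambda>\<Theta>. 1 - 2 * r * (x 0 * cos \<Theta> - x 1 * sin \<Theta>) + r\<^sup>2"
    and "h' \<equiv> \<lambda>\<Theta>. - x 0 * sin \<Theta> - x 1 * cos \<Theta>"
    and "c \<equiv> (1 - r\<^sup>2) / sphere_area n"
  shows has_real_derivative_poisson_kernel_rotation12:
      "((\<lambda>\<Theta>. poisson_kernel n lam r (rotation12 \<Theta> x)) has_real_derivative
         c * (2 * r * (lam + 1) * h' \<Theta> * D \<Theta> powr (- (lam + 2)))) (at \<Theta>)"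
    and has_real_derivative_deriv_poisson_kernel_rotation12:
      "(deriv (\<lambda>\<Theta>. poisson_kernel n lam r (rotation12 \<Theta> x)) has_real_derivative
         c * (2 * r * (lam + 1) * ((- x 0 * cos \<Theta> + x 1 * sin \<Theta>) * D \<Theta> powr (- (lam + 2)) +
           2 * r * (lam + 2) * (h' \<Theta>)\<^sup>2 * D \<Theta> powr (- (lam + 3))))) (at \<Theta>)"
proof -
  have pow: "((\<lambda>\<Theta>. D \<Theta> powr (- s)) has_real_derivative
      2 * r * s * h' \<Theta> * D \<Theta> powr (- (s + 1))) (at \<Theta>)" for s \<Theta>
    unfolding D_def h'_def
    by (intro has_real_derivative_poisson_denominator_powr poisson_denominator_pos assms(1-3))
  have first: "((\<lambda>\<Theta>. poisson_kernel n lam r (rotation12 \<Theta> x)) has_real_derivative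
      c * (2 * r * (lam + 1) * h' \<Theta> * D \<Theta> powr (- (lam + 2)))) (at \<Theta>)" for \<Theta>
    using DERIV_cmult[OF pow[of "lam + 1" \<Theta>], of c]
    unfolding poisson_kernel_rotation12 D_def c_def by (simp add: add.assoc)
  then show "((\<lambda>\<Theta>. poisson_kernel n lam r (rotation12 \<Theta> x)) has_real_derivative
      c * (2 * r * (lam + 1) * h' \<Theta> * D \<Theta> powr (- (lam + 2)))) (at \<Theta>)" .
  have "deriv (\<lambda>\<Theta>. poisson_kernel n lam r (rotation12 \<Theta> x)) =
      (\<lambda>\<Theta>. c * (2 * r * (lam + 1)) * (h' \<Theta> * D \<Theta> powr (- (lam + 2))))"
    using DERIV_imp_deriv[OF first] by (simp add: fun_eq_iff mult_ac)
  moreover have "(h' has_real_derivative - x 0 * cos \<Theta> + x 1 * sin \<Theta>) (at \<Theta>)"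
    unfolding h'_def by (auto intro!: derivative_eq_intros)
  from DERIV_cmult[OF DERIV_mult[OF this pow[of "lam + 2" \<Theta>]], of "c * (2 * r * (lam + 1))"]
  have "((\<lambda>\<Theta>. c * (2 * r * (lam + 1)) * (h' \<Theta> * D \<Theta> powr (- (lam + 2)))) has_real_derivative
      c * (2 * r * (lam + 1) * ((- x 0 * cos \<Theta> + x 1 * sin \<Theta>) * D \<Theta> powr (- (lam + 2)) +
        2 * r * (lam + 2) * (h' \<Theta>)\<^sup>2 * D \<Theta> powr (- (lam + 3))))) (at \<Theta>)"
    by (rule DERIV_cong) (simp add: algebra_simps power2_eq_square)
  ultimately show "(deriv (\<lambda>\<Theta>. poisson_kernel n lam r (rotation12 \<Theta> x)) has_real_derivative
      c * (2 * r * (lam + 1) * ((- x 0 * cos \<Theta> + x 1 * sin \<Theta>) * D \<Theta> powr (- (lam + 2)) +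
        2 * r * (lam + 2) * (h' \<Theta>)\<^sup>2 * D \<Theta> powr (- (lam + 3))))) (at \<Theta>)"
    by simp
qed

text \<open>For \<open>n \<ge> 3\<close> both \<open>\<theta>\<^sub>1\<close> and \<open>\<theta>\<^sub>2\<close> are polar angles, so the second coordinate is governed by a
  cosine; on the two-sphere it would be \<open>sin \<theta>\<^sub>1 cos \<phi>\<close>.\<close>
lemma spherical_coordinates_first_two:
  assumes "spherical_coordinates n \<theta> \<phi> x" "n \<ge> 3"
  shows "x 0 = cos (\<theta> 1)" "x 1 = sin (\<theta> 1) * cos (\<theta> 2)"
proof -
  have coord: "x (k - 1) = (\<Prod>j=1..<k. sin (\<theta> j)) * cos (\<theta> k)" if "k \<in> {1..n-1}" for k
    using assms(1) that unfolding spherical_coordinates_def by blast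
  show "x 0 = cos (\<theta> 1)"
    using coord[of 1] assms(2) by simp
  have "{1..<2::nat} = {1}" by auto
  then show "x 1 = sin (\<theta> 1) * cos (\<theta> 2)"
    using coord[of 2] assms(2) by simp
qed

theorem mainTheorem4:
  fixes n :: nat and lam \<rho> \<phi> :: real and \<theta> x :: "nat \<Rightarrow> real"
  assumes "n \<ge> 3"
    and "lam = (real n - 1) / 2"
    and "\<rho> > 0"
    and "x \<in> topspace (nsphere n)"
    and "spherical_coordinates n \<theta> \<phi> x"
  shows "(\<forall>\<Theta>. (\<lambda>\<Theta>. poisson_kernel n lam (exp (-\<rho>)) (rotation12 \<Theta> x)) differentiable (at \<Theta>)) \<and>
     deriv (\<lambda>\<Theta>. poisson_kernel n lam (exp (-\<rho>)) (rotation12 \<Theta> x)) differentiable (at 0) \<and>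
     directional_deriv 2 (poisson_kernel n lam (exp (-\<rho>))) x =
       - (2 * (lam + 1) * exp (-\<rho>) * (1 - exp (-2 * \<rho>))
           / (sphere_area n *
              (1 - 2 * exp (-\<rho>) * cos (\<theta> 1) + exp (-2 * \<rho>)) powr (lam + 2))) * cos (\<theta> 1)
       + 4 * (lam + 1) * (lam + 2) * exp (-2 * \<rho>) * (1 - exp (-2 * \<rho>))
           / (sphere_area n *
              (1 - 2 * exp (-\<rho>) * cos (\<theta> 1) + exp (-2 * \<rho>)) powr (lam + 3))
           * (sin (\<theta> 1))\<^sup>2 * (cos (\<theta> 2))\<^sup>2"
proof -
  define r where "r = exp (- \<rho>)"
  define D where "D = 1 - 2 * r * cos (\<theta> 1) + r\<^sup>2"
  have r: "0 < r" "r < 1"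
    using assms(3) by (simp_all add: r_def)
  have r2: "exp (-2 * \<rho>) = r\<^sup>2"
    by (simp add: r_def flip: exp_double)
  note x = spherical_coordinates_first_two[OF assms(5,1)]
  have "(sin (\<theta> 1))\<^sup>2 * (cos (\<theta> 2))\<^sup>2 \<le> (sin (\<theta> 1))\<^sup>2 * 1"
    by (intro mult_left_mono) (auto simp: abs_square_le_1)
  then have le: "(x 0)\<^sup>2 + (x 1)\<^sup>2 \<le> 1"
    using sin_cos_squared_add2[of "\<theta> 1"] unfolding x power_mult_distrib by linarith
  note first = has_real_derivative_poisson_kernel_rotation12[OF le r, of n lam]
  note second = has_real_derivative_deriv_poisson_kernel_rotation12[OF le r, of n lam 0]
  have "directional_deriv 2 (poisson_kernel n lam r) x =
      deriv (deriv (\<lambda>\<Theta>. poisson_kernel n lam r (rotation12 \<Theta> x))) 0"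
    by (simp add: directional_deriv_def numeral_2_eq_2)
  also have "\<dots> =
      (1 - r\<^sup>2) / sphere_area n * (2 * r * (lam + 1) * (- cos (\<theta> 1) * D powr (- (lam + 2)) +
        2 * r * (lam + 2) * (sin (\<theta> 1) * cos (\<theta> 2))\<^sup>2 * D powr (- (lam + 3))))"
    unfolding DERIV_imp_deriv[OF second] x by (simp add: D_def)
  also have "\<dots> = - (2 * (lam + 1) * r * (1 - r\<^sup>2) / (sphere_area n * D powr (lam + 2))) * cos (\<theta> 1)
      + 4 * (lam + 1) * (lam + 2) * r\<^sup>2 * (1 - r\<^sup>2) / (sphere_area n * D powr (lam + 3))
          * (sin (\<theta> 1))\<^sup>2 * (cos (\<theta> 2))\<^sup>2"
    unfolding powr_minus by (simp add: divide_inverse power2_eq_square algebra_simps)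
  finally have formula: "directional_deriv 2 (poisson_kernel n lam r) x = \<dots>" .
  show ?thesis
    unfolding r2 r_def[symmetric] D_def[symmetric]
    using first second formula real_differentiable_def by blast
qed

end
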